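(* Let $1\le d\le\ln N$, let $\mathbf{U}\in\mathbb{R}^{N\times d}$ have rank $d$, let $s\in\{1,\dots,N\}$, and let $\mathcal{L}_1=\{\boldsymbol{l}\in[0,1]^N:\boldsymbol{l}=\mathbf{U}\mathbf{v}\text{ for some }\mathbf{v}\in\mathbb{R}^d\}$ and $\mathcal{L}_2=\{\boldsymbol{l}\in[0,1]^N:\|\boldsymbol{l}\|_0=s\}$. Let $p=2\ln(s+1)$ and $q=\frac{p}{p-1}$. Then for every sequence of loss vectors $\boldsymbol{l}_1,\dots,\boldsymbol{l}_T\in\mathcal{L}=\mathcal{L}_1+\mathcal{L}_2$ (Minkowski sum), Online Mirror Descent with regularizer $R(\mathbf{x})=\mathbf{x}^\top\mathbf{H}\mathbf{x}+\|\mathbf{x}\|_q^2$ (on $\Omega=\mathbb{R}^N$) and learning rate $\eta^*=\sqrt{\frac{16d+1}{(2\ln(s+1)-1)T}}$ satisfies $$\mathrm{Regret}_T\le2\sqrt{2(16d+1)\ln(s+1)\,T},$$ where $\mathbf{H}=\mathbf{I}_N+\mathbf{U}\mathbf{M}\mathbf{U}^\top$ is the matrix defined in the context.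
   Context: The matrix $\mathbf{H}$: for $\mathbf{U}\in\mathbb{R}^{N\times d}$ of rank $d$, let $K=\{\mathbf{v}\in\mathbb{R}^d:\|\mathbf{U}\mathbf{v}\|_\infty\le1\}$, and let $\mathbf{M}\in\mathbb{R}^{d\times d}$ be the positive definite matrix such that $\{\mathbf{v}\in\mathbb{R}^d:\mathbf{v}^\top\mathbf{M}^{-1}\mathbf{v}\le1\}$ is the Löwner–John ellipsoid (minimum-volume enclosing ellipsoid) of the symmetric convex body $K$. Then $\mathbf{H}=\mathbf{I}_N+\mathbf{U}\mathbf{M}\mathbf{U}^\top$, with $\mathbf{I}_N$ the identity matrix. Notation: $\Delta_N=\{\mathbf{x}\in[0,1]^N:\sum_i x_i=1\}$; $\|\mathbf{x}\|_0$ is the number of nonzero coordinates; $\|\mathbf{x}\|_q=(\sum_i|x_i|^q)^{1/q}$. Prediction with expert advice: in each round $t=1,\dots,T$ the learner plays $\mathbf{p}_t\in\Delta_N$ (depending on $\boldsymbol{l}_1,\dots,\boldsymbol{l}_{t-1}$), then the loss vector $\boldsymbol{l}_t\in\mathbb{R}^N$ is revealed and the learner suffers $\mathbf{p}_t\cdot\boldsymbol{l}_t$. The regret is $\mathrm{Regret}_T=\sum_{t=1}^T\mathbf{p}_t\cdot\boldsymbol{l}_t-\min_{i\in\{1,\dots,N\}}\sum_{t=1}^T l_t(i)$. Online Mirror Descent with learning rate $\eta>0$, convex set $\Omega\supseteq\Delta_N$ and strictly convex differentiable regularizer $R:\Omega\to\mathbb{R}$: start with $\mathbf{p}_1=\operatorname{argmin}_{\mathbf{p}\in\Delta_N}R(\mathbf{p})$;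 after observing $\boldsymbol{l}_t$, let $\tilde{\mathbf{p}}_{t+1}\in\Omega$ satisfy $\nabla R(\tilde{\mathbf{p}}_{t+1})=\nabla R(\mathbf{p}_t)-\eta\boldsymbol{l}_t$, and set $\mathbf{p}_{t+1}=\operatorname{argmin}_{\mathbf{p}\in\Delta_N}B_R(\mathbf{p},\tilde{\mathbf{p}}_{t+1})$, where $B_R(\mathbf{u},\mathbf{v})=R(\mathbf{u})-R(\mathbf{v})-(\mathbf{u}-\mathbf{v})\cdot\nabla R(\mathbf{v})$. *)

theory Defs
  imports "HOL-Analysis.Analysis"
begin

definition pos_def :: "real^'n^'n \<Rightarrow> bool" where
  "pos_def A \<longleftrightarrow> transpose A = A \<and> (\<forall>x. x \<noteq> 0 \<longrightarrow> x \<bullet> (A *v x) > 0)"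

definition ellipsoid :: "real^'n \<Rightarrow> real^'n^'n \<Rightarrow> (real^'n) set" where
  "ellipsoid c A = {v. (v - c) \<bullet> (matrix_inv A *v (v - c)) \<le> 1}"

(* The competitors range over all enclosing ellipsoids, not only those centred at the origin. *)
definition loewner_john_ellipsoid :: "(real^'n) set \<Rightarrow> (real^'n) set \<Rightarrow> bool" where
  "loewner_john_ellipsoid K E \<longleftrightarrow>
     (\<exists>c A. pos_def A \<and> E = ellipsoid c A) \<and> K \<subseteq> E \<and>
     (\<forall>c A. pos_def A \<and> K \<subseteq> ellipsoid c A
        \<longrightarrow> measure lebesgue E \<le> measure lebesgue (ellipsoid c A))"

definition sup_ball :: "real^'d^'n \<Rightarrow> (real^'d) set" where
  "sup_ball U = {v. infnorm (U *v v) \<le> 1}"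

definition loewner_john_matrix :: "real^'d^'n \<Rightarrow> real^'d^'d \<Rightarrow> bool" where
  "loewner_john_matrix U M \<longleftrightarrow> pos_def M \<and>
     loewner_john_ellipsoid (sup_ball U) {v. v \<bullet> (matrix_inv M *v v) \<le> 1}"

definition H_matrix :: "real^'d^'n \<Rightarrow> real^'d^'d \<Rightarrow> real^'n^'n" where
  "H_matrix U M = mat 1 + U ** M ** transpose U"

definition simplex_points :: "(real^'n) set" where
  "simplex_points = {x. (\<forall>i. 0 \<le> x $ i \<and> x $ i \<le> 1) \<and> (\<Sum>i\<in>UNIV. x $ i) = 1}"

definition l0_norm :: "real^'n \<Rightarrow> nat" where
  "l0_norm x = card {i. x $ i \<noteq> 0}"

definition lq_norm :: "real \<Rightarrow> real^'n \<Rightarrow> real" where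
  "lq_norm q x = (\<Sum>i\<in>UNIV. \<bar>x $ i\<bar> powr q) powr (1 / q)"

definition subspace_losses :: "real^'d^'n \<Rightarrow> (real^'n) set" where
  "subspace_losses U = {l. (\<forall>i. 0 \<le> l $ i \<and> l $ i \<le> 1) \<and> (\<exists>v. l = U *v v)}"

definition sparse_losses :: "nat \<Rightarrow> (real^'n) set" where
  "sparse_losses s = {l. (\<forall>i. 0 \<le> l $ i \<and> l $ i \<le> 1) \<and> l0_norm l = s}"

definition gradient :: "('a::real_inner \<Rightarrow> real) \<Rightarrow> 'a \<Rightarrow> 'a" where
  "gradient R x = (THE g. GDERIV R x :> g)"

definition bregman :: "('a::real_inner \<Rightarrow> real) \<Rightarrow> 'a \<Rightarrow> 'a \<Rightarrow> real" where
  "bregman R u v = R u - R v - (u - v) \<bullet> gradient R v"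

(* The plays w 1, ..., w T form a run of Online Mirror Descent against the losses
   l 1, ..., l T; the witness y is the unprojected iterate. *)
definition omd_run ::
  "(real^'n) set \<Rightarrow> (real^'n \<Rightarrow> real) \<Rightarrow> real \<Rightarrow> nat \<Rightarrow> (nat \<Rightarrow> real^'n) \<Rightarrow> (nat \<Rightarrow> real^'n) \<Rightarrow> bool"
where
  "omd_run \<Omega> R \<eta> T l w \<longleftrightarrow>
     is_arg_min R (\<lambda>x. x \<in> simplex_points) (w 1) \<and>
     (\<forall>t\<in>{1..<T}. \<exists>y\<in>\<Omega>.
        gradient R y = gradient R (w t) - \<eta> *\<^sub>R l t \<and>
        is_arg_min (\<lambda>x. bregman R x y) (\<lambda>x. x \<in> simplex_points) (w (Suc t)))"

definition regret :: "nat \<Rightarrow> (nat \<Rightarrow> real^'n) \<Rightarrow> (nat \<Rightarrow> real^'n) \<Rightarrow> real" where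
  "regret T l w = (\<Sum>t=1..T. w t \<bullet> l t) - (MIN i\<in>UNIV. \<Sum>t=1..T. l t $ i)"

end

theory Submission
  imports Defs
begin

text \<open>On the simplex the Bregman divergence of R at u, x dominates, with \<delta> = u - x, the form
  \<delta> \<bullet> H \<delta> plus (for 1 < q < 2) q - 1 times the squared q-norm of \<delta>.
  The subspace part of a loss is paired with the M-part of H, because the ellipsoid encloses the
  body; the sparse part is paired with the q-norm by Hoelder's inequality, and s^(2/p) is at most e.
  Minimality of the ellipsoid enters only in bounding R at the i-th vertex: let u be the i-th row
  of U and suppose u \<bullet> M u > 4d. The body lies in the slab \<bar>u \<bullet> v\<bar> \<le> 1, so the ellipsoid with
  form \<beta> (v \<bullet> M^(-1) v) + \<gamma> (u \<bullet> v)^2 \<le> 1, where \<gamma> = 1/(2d) and \<beta> = 1 - \<gamma>, encloses it with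
  smaller volume. John's sharp bound d is not needed, since the constant 16d + 1 leaves room.\<close>

section \<open>Volume under linear maps\<close>

text \<open>Every linear map is composed of maps that kill a coordinate, stretch the axes, swap two
  coordinates or shear, and each of these scales volume by a constant. The factor stays existential
  because it cancels in the conjugation argument that follows.\<close>

lemma linear_image_measure_scaling:
  fixes f :: "real^'n \<Rightarrow> real^'n"
  assumes "linear f"
  shows "\<exists>c. \<forall>S\<in>lmeasurable. f ` S \<in> lmeasurable \<and> measure lebesgue (f ` S) = c * measure lebesgue S"
proof (rule induct_linear_elementary [OF assms])
  fix f g :: "real^'n \<Rightarrow> real^'n"
  assume "\<exists>c. \<forall>S\<in>lmeasurable. f ` S \<in> lmeasurable \<and> measure lebesgue (f ` S) = c * measure lebesgue S"
    and "\<exists>c. \<forall>S\<in>lmeasurable. g ` S \<in> lmeasurable \<and> measure lebesgue (g ` S) = c * measure lebesgue S"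
  then obtain c d where
    "\<forall>S\<in>lmeasurable. f ` S \<in> lmeasurable \<and> measure lebesgue (f ` S) = c * measure lebesgue S"
    "\<forall>S\<in>lmeasurable. g ` S \<in> lmeasurable \<and> measure lebesgue (g ` S) = d * measure lebesgue S"
    by blast
  then have "\<forall>S\<in>lmeasurable. (f \<circ> g) ` S \<in> lmeasurable \<and>
      measure lebesgue ((f \<circ> g) ` S) = (c * d) * measure lebesgue S"
    unfolding image_comp [symmetric] by simp
  then show "\<exists>c. \<forall>S\<in>lmeasurable. (f \<circ> g) ` S \<in> lmeasurable \<and>
      measure lebesgue ((f \<circ> g) ` S) = c * measure lebesgue S" by blast
next
  fix f :: "real^'n \<Rightarrow> real^'n" and i
  assume f: "linear f" "\<And>x. f x $ i = 0"
  then have "\<not> inj f"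
    by (metis (full_types) linear_injective_imp_surjective one_neq_zero surjE vec_component)
  then have "negligible (f ` S)" for S
    using f negligible_linear_singular_image by blast
  then have "\<forall>S\<in>lmeasurable. f ` S \<in> lmeasurable \<and> measure lebesgue (f ` S) = 0 * measure lebesgue S"
    by (simp add: negligible_iff_measure)
  then show "\<exists>c. \<forall>S\<in>lmeasurable. f ` S \<in> lmeasurable \<and> measure lebesgue (f ` S) = c * measure lebesgue S"
    by blast
next
  fix m :: "'n \<Rightarrow> real"
  show "\<exists>c. \<forall>S\<in>lmeasurable. (\<lambda>x. \<chi> i. m i * x $ i) ` S \<in> lmeasurable \<and>
      measure lebesgue ((\<lambda>x. \<chi> i. m i * x $ i) ` S) = c * measure lebesgue S"
    using measurable_stretch measure_stretch by blast
next
  fix m n :: 'n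
  let ?h = "\<lambda>x::real^'n. \<chi> i. x $ Transposition.transpose m n i"
  have "linear ?h"
    by (rule linearI) (simp_all add: plus_vec_def scaleR_vec_def)
  moreover have "measure lebesgue (?h ` cbox a b) = 1 * measure lebesgue (cbox a b)" for a b
  proof (cases "cbox a b = {}")
    case False
    have eq: "?h ` cbox a b = cbox (?h a) (?h b)"
      by (auto simp: image_iff lambda_swap_Galois mem_box_cart) (metis transpose_involutory)+
    have "?h ` cbox a b \<noteq> {}"
      using False by blast
    then show ?thesis
      using prod.permute [OF permutes_swap_id, where S = UNIV and g = "\<lambda>i. (b - a) $ i", symmetric]
      by (simp add: eq content_cbox_cart False)
  qed simp
  ultimately show "\<exists>c. \<forall>S\<in>lmeasurable. ?h ` S \<in> lmeasurable \<and> measure lebesgue (?h ` S) = c * measure lebesgue S"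
    using measure_linear_sufficient [of ?h _ 1] by metis
next
  fix m n :: 'n
  assume "m \<noteq> n"
  define h where "h = (\<lambda>x::real^'n. \<chi> i. if i = m then x $ m + x $ n else x $ i)"
  have lin: "linear h"
    unfolding h_def by (rule linearI) (auto simp: algebra_simps plus_vec_def scaleR_vec_def vec_eq_iff)
  have "measure lebesgue (h ` cbox a b) = 1 * measure lebesgue (cbox a b)" for a b
  proof (cases "cbox a b = {}")
    case False
    \<comment> \<open>By linearity a translation of the box only translates its image, so the shear
      has to be computed only for boxes with lower corner 0.\<close>
    have ab: "cbox a b = (+) a ` cbox 0 (b - a)"
      using cbox_translation [of a 0 "b - a"] by simp
    have "h ` cbox a b = (+) (h a) ` h ` cbox 0 (b - a)"
      unfolding ab image_image by (rule image_cong [OF refl]) (rule linear_add [OF lin])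
    then show ?thesis
      using False ab measure_shear_interval [OF \<open>m \<noteq> n\<close>, of 0 "b - a", folded h_def]
      by (simp add: measure_translation)
  qed simp
  then have "\<forall>S\<in>lmeasurable. h ` S \<in> lmeasurable \<and> measure lebesgue (h ` S) = 1 * measure lebesgue S"
    using measure_linear_sufficient [OF lin] by metis
  then show "\<exists>c. \<forall>S\<in>lmeasurable. (\<lambda>x::real^'n. \<chi> i. if i = m then x $ m + x $ n else x $ i) ` S \<in> lmeasurable \<and>
      measure lebesgue ((\<lambda>x::real^'n. \<chi> i. if i = m then x $ m + x $ n else x $ i) ` S) = c * measure lebesgue S"
    unfolding h_def by (rule exI)
qed

text \<open>The map stretches the direction m by the factor 1 + k (u \<bullet> m) and fixes the hyperplane
  orthogonal to u, so it is conjugate to a stretch along a coordinate axis.\<close>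

lemma measure_rank_one_update:
  fixes u m :: "real^'n" and S :: "(real^'n) set"
  assumes um: "u \<bullet> m \<noteq> 0" and S: "S \<in> lmeasurable"
  shows "measure lebesgue ((\<lambda>v. v + (k * (u \<bullet> v)) *\<^sub>R m) ` S) = \<bar>1 + k * (u \<bullet> m)\<bar> * measure lebesgue S"
proof -
  let ?T = "\<lambda>v. v + (k * (u \<bullet> v)) *\<^sub>R m"
  obtain i where i: "u $ i \<noteq> 0"
    using um by (metis inner_zero_left vec_eq_iff zero_index)
  \<comment> \<open>Since \<open>P\<close> ignores coordinate i, putting \<open>- P x\<close> there
    yields a vector orthogonal to u. So \<open>A\<close> carries the i-th axis to the line of m and
    the other axes into the hyperplane orthogonal to u. \<open>B\<close> inverts it by first reading
    off the coefficient of m, and \<open>?D\<close> is the stretch in these coordinates.\<close>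
  define P where "P x = (\<Sum>j\<in>UNIV - {i}. u $ j * x $ j) / u $ i" for x :: "real^'n"
  define A where "A x = (x $ i) *\<^sub>R m + (\<chi> j. if j = i then - P x else x $ j)" for x
  define B where "B v = (let t = (u \<bullet> v) / (u \<bullet> m) in
      \<chi> j. if j = i then t else v $ j - t * m $ j)" for v
  let ?D = "\<lambda>x::real^'n. \<chi> j. (if j = i then 1 + k * (u \<bullet> m) else 1) * x $ j"
  have P: "P (x + y) = P x + P y" "P (c *\<^sub>R x) = c * P x" for x y c
    by (simp_all add: P_def sum.distrib distrib_left add_divide_distrib sum_distrib_left mult.left_commute)
  have linA: "linear A"
    by (rule linearI) (auto simp: A_def P vec_eq_iff algebra_simps)
  have linB: "linear B"
    by (rule linearI) (auto simp: B_def Let_def vec_eq_iff inner_add_right field_simps add_divide_distrib)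
  have linT: "linear ?T"
    by (rule linearI) (auto simp: inner_add_right algebra_simps)
  have dot: "u \<bullet> x = u $ i * x $ i + u $ i * P x" for x
    using i by (simp add: inner_vec_def P_def sum.remove [of UNIV i])
  have Pcong: "P x = P y" if "\<And>j. j \<noteq> i \<Longrightarrow> x $ j = y $ j" for x y
    using that by (simp add: P_def)
  have uA: "u \<bullet> A x = (u \<bullet> m) * x $ i" for x
  proof -
    have "P (\<chi> j. if j = i then - P x else x $ j) = P x"
      by (rule Pcong) simp
    then show ?thesis
      by (simp add: A_def inner_add_right dot [of "\<chi> j. if j = i then - P x else x $ j"])
  qed
  have AB: "A (B v) = v" for v
  proof -
    define t where "t = (u \<bullet> v) / (u \<bullet> m)"
    have "P (B v) = P (v - t *\<^sub>R m)"
      by (rule Pcong) (simp add: B_def t_def [symmetric])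
    also have "\<dots> = P v - t * P m"
      using P(1) [of v "- t *\<^sub>R m"] P(2) [of "- t" m] by simp
    finally have "P (B v) = P v - t * P m" .
    moreover have "u $ i * v $ i + u $ i * P v = t * (u $ i * m $ i + u $ i * P m)"
      using um unfolding t_def dot [symmetric] by simp
    then have "v $ i + P v = t * (m $ i + P m)"
      using i by (metis (no_types, opaque_lifting) distrib_left mult.left_commute mult_left_cancel)
    ultimately show ?thesis
      by (auto simp: A_def vec_eq_iff B_def t_def [symmetric] algebra_simps)
  qed
  have TA: "?T \<circ> A = A \<circ> ?D"
  proof
    fix x
    have "P (?D x) = P x"
      by (rule Pcong) simp
    then show "(?T \<circ> A) x = (A \<circ> ?D) x"
      unfolding comp_def uA by (simp add: A_def vec_eq_iff algebra_simps)
  qed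
  obtain a where a: "\<And>S. S \<in> lmeasurable \<Longrightarrow> A ` S \<in> lmeasurable"
      "\<And>S. S \<in> lmeasurable \<Longrightarrow> measure lebesgue (A ` S) = a * measure lebesgue S"
    using linear_image_measure_scaling [OF linA] by blast
  have b: "B ` S \<in> lmeasurable"
    if "S \<in> lmeasurable" for S
    using linear_image_measure_scaling [OF linB] that by blast
  have D: "?D ` R \<in> lmeasurable"
    "measure lebesgue (?D ` R) = \<bar>1 + k * (u \<bullet> m)\<bar> * measure lebesgue R" if "R \<in> lmeasurable" for R
    using measurable_stretch [OF that] measure_stretch [OF that] by (simp_all add: prod.If_cases)
  define R where "R = B ` S"
  have R: "R \<in> lmeasurable" "S = A ` R"
    using b S by (auto simp: R_def image_image AB)
  \<comment> \<open>Both \<open>S\<close> and its image under \<open>?T\<close> are images under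
    \<open>A\<close>, so the unknown factor of \<open>A\<close> appears on both sides and only the
    stretch factor of \<open>?D\<close> remains.\<close>
  have "?T ` S = A ` ?D ` R"
    unfolding R(2) image_comp TA ..
  then show ?thesis
    using a D R by simp
qed

section \<open>The width of the minimal ellipsoid\<close>

lemma inner_matrix_symmetric:
  fixes A :: "real^'n^'n"
  assumes "transpose A = A"
  shows "x \<bullet> (A *v y) = y \<bullet> (A *v x)"
  using assms dot_lmul_matrix [of x A y] by (metis inner_commute transpose_matrix_vector)

lemma matrix_inv_inverse:
  fixes A :: "real^'n^'n"
  assumes "invertible A"
  shows "A ** matrix_inv A = mat 1" "matrix_inv A ** A = mat 1"
  using assms someI_ex [of "\<lambda>B. A ** B = mat 1 \<and> B ** A = mat 1"]
  by (auto simp: invertible_def matrix_inv_def)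

lemma pos_def_invertible:
  assumes "pos_def A"
  shows "invertible A"
proof -
  have "inj ((*v) A)"
    using assms unfolding pos_def_def vec.inj_iff_eq_0 by (metis inner_zero_right less_irrefl)
  then show ?thesis
    by (simp add: matrix_left_invertible_injective invertible_left_inverse)
qed

lemma pos_def_inverse_vector:
  assumes "pos_def A"
  shows "A *v (matrix_inv A *v x) = x" "matrix_inv A *v (A *v x) = x"
  using matrix_inv_inverse [OF pos_def_invertible [OF assms]]
  by (simp_all add: matrix_vector_mul_assoc)

lemma pos_def_matrix_inv:
  assumes "pos_def A"
  shows "pos_def (matrix_inv A)"
proof -
  let ?B = "matrix_inv A"
  note AB = matrix_inv_inverse [OF pos_def_invertible [OF assms]]
  have tA: "transpose A = A"
    using assms by (simp add: pos_def_def)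
  have "transpose ?B ** A = mat 1"
    by (metis AB(1) matrix_transpose_mul tA transpose_mat)
  then have "transpose ?B = ?B"
    by (metis AB(1) matrix_mul_assoc matrix_mul_lid matrix_mul_rid)
  moreover have "x \<bullet> (?B *v x) > 0" if "x \<noteq> 0" for x
  proof -
    define y where "y = ?B *v x"
    have "A *v y = x"
      by (simp add: y_def pos_def_inverse_vector [OF assms])
    moreover from this have "y \<noteq> 0"
      using that by auto
    then have "y \<bullet> (A *v y) > 0"
      using assms by (simp add: pos_def_def)
    ultimately show ?thesis
      by (simp add: inner_commute y_def)
  qed
  ultimately show ?thesis
    by (simp add: pos_def_def)
qed

lemma matrix_inv_matrix_inv:
  assumes "pos_def A"
  shows "matrix_inv (matrix_inv A) = A"
proof -
  note * = matrix_inv_inverse [OF pos_def_invertible [OF assms]]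
    matrix_inv_inverse [OF pos_def_invertible [OF pos_def_matrix_inv [OF assms]]]
  then show ?thesis
    by (metis matrix_mul_assoc matrix_mul_lid matrix_mul_rid)
qed

lemma pos_def_nonneg:
  assumes "pos_def A"
  shows "0 \<le> x \<bullet> (A *v x)"
  using assms by (cases "x = 0") (auto simp: pos_def_def less_imp_le)

text \<open>The set is compact: the form has a positive minimum c on the unit sphere, and by
  homogeneity every point of the set has norm at most 1 / sqrt c.\<close>

lemma pos_def_ellipsoid_lmeasurable:
  fixes B :: "real^'n^'n"
  assumes "pos_def B"
  shows "{v. v \<bullet> (B *v v) \<le> 1} \<in> lmeasurable"
proof (rule lmeasurable_compact)
  have cont: "continuous_on S (\<lambda>v. v \<bullet> (B *v v))" for S
    by (intro continuous_intros)
  obtain z where z: "z \<in> sphere (0::real^'n) 1" "\<And>v. v \<in> sphere 0 1 \<Longrightarrow> z \<bullet> (B *v z) \<le> v \<bullet> (B *v v)"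
    using continuous_attains_inf [OF compact_sphere _ cont, of 0 1] by force
  define c where "c = z \<bullet> (B *v z)"
  have c: "c > 0"
    using assms z(1) unfolding c_def pos_def_def by (metis norm_zero mem_sphere_0 zero_neq_one)
  have "norm v \<le> 1 / sqrt c" if "v \<bullet> (B *v v) \<le> 1" for v
  proof (cases "v = 0")
    case False
    define w where "w = v /\<^sub>R norm v"
    have "c \<le> w \<bullet> (B *v w)"
      using z(2) [of w] False by (simp add: c_def w_def)
    also have "\<dots> = (v \<bullet> (B *v v)) / (norm v)\<^sup>2"
      by (simp add: w_def matrix_vector_mult_scaleR power2_eq_square divide_inverse)
    finally have "c * (norm v)\<^sup>2 \<le> 1"
      using False that by (simp add: field_simps)
    then have "sqrt (c * (norm v)\<^sup>2) \<le> 1"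
      by simp
    then show ?thesis
      using c by (simp add: real_sqrt_mult field_simps)
  qed (use c in simp)
  then have "bounded {v. v \<bullet> (B *v v) \<le> 1}"
    by (auto simp: bounded_iff)
  moreover have "closed {v. v \<bullet> (B *v v) \<le> 1}"
    by (intro closed_Collect_le cont continuous_on_const)
  ultimately show "compact {v. v \<bullet> (B *v v) \<le> 1}"
    by (simp add: compact_eq_bounded_closed)
qed

lemma pos_def_ellipsoid_measure_pos:
  fixes B :: "real^'n^'n"
  assumes "pos_def B"
  shows "0 < measure lebesgue {v. v \<bullet> (B *v v) \<le> 1}"
proof -
  have "open {v. v \<bullet> (B *v v) < 1}"
    by (intro open_Collect_less continuous_intros)
  moreover have "0 \<in> {v. v \<bullet> (B *v v) < 1}"
    by simp
  ultimately have "\<not> negligible {v. v \<bullet> (B *v v) < 1}"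
    using open_not_negligible by blast
  then have "\<not> negligible {v. v \<bullet> (B *v v) \<le> 1}"
    by (rule contrapos_nn) (rule negligible_subset, auto)
  then show ?thesis
    using negligible_iff_measure0 [OF pos_def_ellipsoid_lmeasurable [OF assms]]
    by (metis measure_nonneg order_le_less)
qed

lemma loewner_john_width:
  fixes K :: "(real^'n) set" and M :: "real^'n^'n"
  assumes M: "pos_def M"
    and LJ: "loewner_john_ellipsoid K {v. v \<bullet> (matrix_inv M *v v) \<le> 1}"
    and slab: "\<And>v. v \<in> K \<Longrightarrow> \<bar>u \<bullet> v\<bar> \<le> 1"
  shows "u \<bullet> (M *v u) \<le> 4 * real CARD('n)"
proof (rule ccontr)
  assume contra: "\<not> ?thesis"
  define m where "m = M *v u"
  define \<rho> where "\<rho> = u \<bullet> m"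
  define d where "d = real CARD('n)"
  define P where "P = matrix_inv M"
  \<comment> \<open>The weight 1/(2d) is small enough that Bernoulli's inequality keeps \<beta>^d at
    least 1/2, and large enough that \<gamma> \<rho> is at least 2 when \<rho> exceeds 4d.\<close>
  define \<gamma> where "\<gamma> = 1 / (2 * d)"
  define \<beta> where "\<beta> = 1 - \<gamma>"
  have \<rho>: "\<rho> > 4 * d" and d: "d \<ge> 1"
    using contra by (simp_all add: \<rho>_def m_def d_def Suc_leI)
  have \<gamma>: "\<gamma> > 0" "\<gamma> \<le> 1 / 2" and \<beta>: "\<beta> > 0"
    using d by (simp_all add: \<gamma>_def \<beta>_def field_simps)
  have P: "pos_def P"
    using M by (simp add: P_def pos_def_matrix_inv)
  have Pm: "P *v m = u"
    by (simp add: P_def m_def pos_def_inverse_vector [OF M])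
  have Psym: "x \<bullet> (P *v y) = y \<bullet> (P *v x)" for x y
    using P by (intro inner_matrix_symmetric) (simp add: pos_def_def)

  define B where "B = (\<chi> i j. \<beta> * P $ i $ j + \<gamma> * u $ i * u $ j)"
  have Bv: "B *v v = \<beta> *\<^sub>R (P *v v) + (\<gamma> * (u \<bullet> v)) *\<^sub>R u" for v
    by (simp add: B_def vec_eq_iff matrix_vector_mult_def inner_vec_def algebra_simps
        sum.distrib sum_distrib_left)
  have quad: "v \<bullet> (B *v v) = \<beta> * (v \<bullet> (P *v v)) + \<gamma> * (u \<bullet> v)\<^sup>2" for v
    by (simp add: Bv inner_add_right power2_eq_square inner_commute)
  have B: "pos_def B"
    unfolding pos_def_def
  proof (intro conjI allI impI)
    have "P $ i $ j = P $ j $ i" for i j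
      using P unfolding pos_def_def by (metis transpose_def vec_lambda_beta)
    then show "transpose B = B"
      by (simp add: B_def transpose_def vec_eq_iff mult.commute mult.left_commute)
    show "0 < x \<bullet> (B *v x)" if "x \<noteq> 0" for x
      using P that \<beta> \<gamma> unfolding quad pos_def_def
      by (intro add_pos_nonneg mult_pos_pos) auto
  qed

  define E1 where "E1 = {v. v \<bullet> (P *v v) \<le> 1}"
  define E2 where "E2 = {v. v \<bullet> (B *v v) \<le> 1}"
  \<comment> \<open>\<open>ellipsoid\<close> inverts its matrix argument, so the competitor with
    form \<open>B\<close> is entered through \<open>matrix_inv B\<close>.\<close>
  have "E2 = ellipsoid 0 (matrix_inv B)"
    by (simp add: E2_def ellipsoid_def matrix_inv_matrix_inv [OF B])
  moreover have "K \<subseteq> E2"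
  proof
    fix v assume v: "v \<in> K"
    then have "v \<bullet> (P *v v) \<le> 1"
      using LJ by (auto simp: loewner_john_ellipsoid_def P_def)
    moreover have "(u \<bullet> v)\<^sup>2 \<le> 1"
      using slab [OF v] by (simp add: abs_square_le_1)
    ultimately have "v \<bullet> (B *v v) \<le> \<beta> * 1 + \<gamma> * 1"
      unfolding quad using \<beta> \<gamma> by (intro add_mono mult_left_mono) auto
    then show "v \<in> E2"
      by (simp add: E2_def \<beta>_def)
  qed
  ultimately have le: "measure lebesgue E1 \<le> measure lebesgue E2"
    using LJ pos_def_matrix_inv [OF B] by (simp add: loewner_john_ellipsoid_def E1_def P_def)

  text \<open>k is chosen so that v \<mapsto> sqrt \<beta> (v + k (u \<bullet> v) m) maps E2 onto E1.\<close>
  define \<tau> where "\<tau> = sqrt (1 + \<gamma> * \<rho> / \<beta>)"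
  define k where "k = (\<tau> - 1) / \<rho>"
  define T where "T = (\<lambda>v. v + (k * (u \<bullet> v)) *\<^sub>R m)"
  have \<tau>: "\<tau> > 0" "\<tau>\<^sup>2 = 1 + \<gamma> * \<rho> / \<beta>" "1 + k * \<rho> = \<tau>"
    using \<rho> d \<gamma> \<beta> by (simp_all add: \<tau>_def k_def add_pos_nonneg add_nonneg_nonneg)
  have quadT: "T v \<bullet> (P *v T v) = v \<bullet> (P *v v) + (\<gamma> / \<beta>) * (u \<bullet> v)\<^sup>2" for v
  proof -
    have "T v \<bullet> (P *v T v) = v \<bullet> (P *v v) + (2 * k + k\<^sup>2 * \<rho>) * (u \<bullet> v)\<^sup>2"
      using Psym [of m v]
      by (simp add: T_def matrix_vector_right_distrib matrix_vector_mult_scaleR Pm inner_add_left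
          inner_add_right \<rho>_def inner_commute power2_eq_square algebra_simps)
    \<comment> \<open>Multiplication by \<rho> completes the square. Hence the coefficient equals
      \<gamma> / \<beta> exactly when 1 + k \<rho> is a square root of 1 + \<gamma> \<rho> /
      \<beta>, which is \<tau>.\<close>
    moreover have "(2 * k + k\<^sup>2 * \<rho>) * \<rho> = (1 + k * \<rho>)\<^sup>2 - 1"
      by (simp add: power2_eq_square algebra_simps)
    then have "(2 * k + k\<^sup>2 * \<rho>) * \<rho> = (\<gamma> / \<beta>) * \<rho>"
      using \<tau> by simp
    then have "2 * k + k\<^sup>2 * \<rho> = \<gamma> / \<beta>"
      using \<rho> d by (subst (asm) mult_right_cancel) auto
    ultimately show ?thesis
      by simp
  qed
  have E1: "E1 = (\<lambda>v. sqrt \<beta> *\<^sub>R v) ` T ` E2"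
  proof -
    \<comment> \<open>The Sherman-Morrison formula for a rank-one update, with denominator 1 + k
      \<rho> = \<tau>.\<close>
    have Tinv: "T (w - (k / \<tau> * (u \<bullet> w)) *\<^sub>R m) = w" for w
    proof -
      have "k * (u \<bullet> w - k / \<tau> * (u \<bullet> w) * \<rho>) = k / \<tau> * (u \<bullet> w) * (\<tau> - k * \<rho>)"
        using \<tau> by (simp add: field_simps)
      also have "\<tau> - k * \<rho> = 1"
        using \<tau> by simp
      finally show ?thesis
        by (simp add: T_def inner_diff_right \<rho>_def)
    qed
    have key: "(sqrt \<beta> *\<^sub>R T v) \<bullet> (P *v (sqrt \<beta> *\<^sub>R T v)) = v \<bullet> (B *v v)" for v
      using \<beta> by (simp add: matrix_vector_mult_scaleR quadT quad algebra_simps flip: mult.assoc)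
    have "v \<in> (\<lambda>v. sqrt \<beta> *\<^sub>R v) ` T ` E2" if "v \<in> E1" for v
    proof -
      define y where "y = (1 / sqrt \<beta>) *\<^sub>R v"
      define x where "x = y - (k / \<tau> * (u \<bullet> y)) *\<^sub>R m"
      have "v = sqrt \<beta> *\<^sub>R T x"
        using \<beta> unfolding x_def Tinv by (simp add: y_def)
      then show ?thesis
        using that key [of x] by (auto simp: E1_def E2_def)
    qed
    then show ?thesis
      using key by (auto simp: E1_def E2_def)
  qed
  have mE2: "E2 \<in> lmeasurable" "measure lebesgue E2 > 0"
    using B by (simp_all add: E2_def pos_def_ellipsoid_lmeasurable pos_def_ellipsoid_measure_pos)
  have "measure lebesgue E1 = sqrt \<beta> ^ CARD('n) * (\<tau> * measure lebesgue E2)"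
  proof -
    have "u \<bullet> m \<noteq> 0"
      using \<rho> d by (simp add: \<rho>_def)
    then have "measure lebesgue (T ` E2) = \<tau> * measure lebesgue E2"
      using measure_rank_one_update [OF _ mE2(1), of u m k] \<tau> by (simp add: T_def \<rho>_def)
    moreover have "measure lebesgue ((\<lambda>v. sqrt \<beta> *\<^sub>R v) ` S) = sqrt \<beta> ^ CARD('n) * measure lebesgue S"
      for S :: "(real^'n) set"
      using measure_lebesgue_affine [of "sqrt \<beta>" 0 S] \<beta> by simp
    ultimately show ?thesis
      by (simp add: E1)
  qed
  with le mE2 have "sqrt \<beta> ^ CARD('n) * \<tau> \<le> 1"
    by (simp add: mult.assoc [symmetric])
  \<comment> \<open>Squaring removes both roots: the volume ratio becomes \<beta>^d (1 + \<gamma>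
    \<rho> / \<beta>), at most 1 by minimality. Its second summand alone is at least 1/2 * 2 and its
    first is positive, a contradiction.\<close>
  then have "(sqrt \<beta> ^ CARD('n) * \<tau>)\<^sup>2 \<le> 1"
    using \<beta> \<tau> by (simp add: power_le_one)
  moreover have "(sqrt \<beta> ^ CARD('n) * \<tau>)\<^sup>2 = \<beta> ^ CARD('n) * (1 + \<gamma> * \<rho> / \<beta>)"
  proof -
    have "(sqrt \<beta> ^ CARD('n))\<^sup>2 = ((sqrt \<beta>)\<^sup>2) ^ CARD('n)"
      by (simp only: power_mult [symmetric] mult.commute)
    then show ?thesis
      using \<beta> by (simp add: power_mult_distrib \<tau>)
  qed
  moreover have "1 / 2 * 2 \<le> \<beta> ^ CARD('n) * (\<gamma> * \<rho> / \<beta>)"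
  proof (rule mult_mono)
    have "1 + real CARD('n) * (- \<gamma>) \<le> (1 + (- \<gamma>)) ^ CARD('n)"
      by (rule Bernoulli_inequality) (use \<gamma> in simp)
    then show "1 / 2 \<le> \<beta> ^ CARD('n)"
      using d by (simp add: \<beta>_def \<gamma>_def d_def)
    have "2 \<le> \<gamma> * \<rho>"
      using \<rho> d by (simp add: \<gamma>_def field_simps)
    also have "\<dots> \<le> \<gamma> * \<rho> / \<beta>"
      using \<beta> \<gamma> \<rho> d by (simp add: pos_le_divide_eq \<beta>_def mult_left_le)
    finally show "2 \<le> \<gamma> * \<rho> / \<beta>" .
  qed (use \<beta> in auto)
  moreover have "0 < \<beta> ^ CARD('n)"
    using \<beta> by simp
  ultimately show False
    by (simp add: distrib_left)
qed

section \<open>The squared q-norm on the simplex\<close>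

text \<open>After both sums are normalised to 1, the weighted inequality of arithmetic and geometric
  means applies term by term. Writing the factors as powers of \<open>a\<close> and \<open>b\<close>
  lets the lemma be used with exponent 1/q as well as q/2.\<close>

lemma Holder_sum:
  fixes a b :: "'i \<Rightarrow> real"
  assumes I: "finite I" and a: "\<And>i. i \<in> I \<Longrightarrow> 0 \<le> a i" and b: "\<And>i. i \<in> I \<Longrightarrow> 0 \<le> b i"
    and t: "0 < t" "t < 1"
  shows "(\<Sum>i\<in>I. a i powr t * b i powr (1 - t)) \<le> sum a I powr t * sum b I powr (1 - t)"
proof (cases "sum a I = 0 \<or> sum b I = 0")
  case True
  \<comment> \<open>A vanishing sum of nonnegative terms makes every term on the left vanish,
    because 0 \<open>powr\<close> any exponent is 0.\<close>
  then have "a i = 0 \<or> b i = 0" if "i \<in> I" for i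
    using that by (auto simp: sum_nonneg_eq_0_iff I a b)
  then have "(\<Sum>i\<in>I. a i powr t * b i powr (1 - t)) = 0"
    by (intro sum.neutral) auto
  then show ?thesis
    by simp
next
  case False
  let ?A = "sum a I" and ?B = "sum b I"
  have pos: "?A > 0" "?B > 0"
    using False a b by (simp_all add: sum_nonneg order_less_le)
  have "(\<Sum>i\<in>I. (a i / ?A) powr t * (b i / ?B) powr (1 - t)) \<le> (\<Sum>i\<in>I. t * (a i / ?A) + (1 - t) * (b i / ?B))"
  proof (rule sum_mono)
    fix i assume i: "i \<in> I"
    show "(a i / ?A) powr t * (b i / ?B) powr (1 - t) \<le> t * (a i / ?A) + (1 - t) * (b i / ?B)"
    proof (cases "a i = 0 \<or> b i = 0")
      case True
      then show ?thesis
        using a [OF i] b [OF i] pos t by auto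
    next
      case False
      then show ?thesis
        using a [OF i] b [OF i] pos t by (intro Youngs_inequality_0) (auto simp: order_less_le)
    qed
  qed
  also have "\<dots> = t * (?A / ?A) + (1 - t) * (?B / ?B)"
    by (simp only: sum.distrib sum_distrib_left sum_divide_distrib)
  also have "\<dots> = 1"
    using pos by simp
  also have "(\<Sum>i\<in>I. (a i / ?A) powr t * (b i / ?B) powr (1 - t)) =
      (\<Sum>i\<in>I. a i powr t * b i powr (1 - t)) / (?A powr t * ?B powr (1 - t))"
    using pos a b unfolding sum_divide_distrib by (intro sum.cong) (auto simp: powr_divide)
  finally show ?thesis
    using pos by (simp add: pos_divide_le_eq)
qed

section \<open>Differentiability and convexity of the squared q-norm\<close>

lemma lq_norm_power2: "(lq_norm q x)\<^sup>2 = (\<Sum>i\<in>UNIV. \<bar>x $ i\<bar> powr q) powr (2 / q)"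
  by (simp add: lq_norm_def power2_eq_square flip: powr_add)

lemma simplex_sum_powr_pos:
  assumes "y \<in> simplex_points"
  shows "0 < (\<Sum>i\<in>UNIV. \<bar>y $ i\<bar> powr q)"
proof -
  obtain i where "y $ i \<noteq> 0"
    using assms unfolding simplex_points_def by (metis (mono_tags, lifting) mem_Collect_eq sum.neutral zero_neq_one)
  then show ?thesis
    by (intro sum_pos2 [of _ i]) auto
qed

text \<open>Simplex points may have zero coordinates, while gradients are taken in the whole space,
  so the two-sided derivative at 0 is required. There the difference quotient is bounded by the
  power q - 1 of the absolute value of h, which tends to 0.\<close>

lemma DERIV_abs_powr:
  assumes q: "1 < q" and t: "0 \<le> (t::real)"
  shows "((\<lambda>x. \<bar>x\<bar> powr q) has_real_derivative q * t powr (q - 1)) (at t)"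
proof (cases "t = 0")
  case False
  then have "((\<lambda>x. x powr q) has_real_derivative q * t powr (q - 1)) (at t)"
    using t by (intro has_real_derivative_powr) auto
  then show ?thesis
    by (rule has_field_derivative_transform_within_open [where S = "{0<..}"]) (use False t in auto)
next
  case True
  have "((\<lambda>h. \<bar>h\<bar> powr (q - 1)) \<longlongrightarrow> \<bar>0::real\<bar> powr (q - 1)) (at 0)"
    using q by (intro tendsto_powr2 tendsto_intros) auto
  then have "((\<lambda>h. \<bar>h\<bar> powr (q - 1)) \<longlongrightarrow> 0) (at (0::real))"
    by simp
  then have "((\<lambda>h. \<bar>h\<bar> powr q / h) \<longlongrightarrow> 0) (at (0::real))"
  proof (rule Lim_null_comparison [rotated])
    show "\<forall>\<^sub>F h in at (0::real). norm (\<bar>h\<bar> powr q / h) \<le> \<bar>h\<bar> powr (q - 1)"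
      unfolding eventually_at by (intro exI [of _ 1]) (auto simp: powr_diff)
  qed
  then show ?thesis
    using True q by (simp add: DERIV_def)
qed

text \<open>The sign factor of the usual gradient is missing, so the formula is meant for points
  with nonnegative coordinates; it is only evaluated on the simplex.\<close>

definition lq_norm_sq_grad :: "real \<Rightarrow> real^'n \<Rightarrow> real^'n" where
  "lq_norm_sq_grad q y =
     (\<chi> i. 2 * (\<Sum>j\<in>UNIV. \<bar>y $ j\<bar> powr q) powr (2 / q - 1) * \<bar>y $ i\<bar> powr (q - 1))"

lemma GDERIV_lq_norm_sq:
  fixes y :: "real^'n"
  assumes q: "1 < q" and y: "y \<in> simplex_points"
  shows "GDERIV (\<lambda>x. (lq_norm q x)\<^sup>2) y :> lq_norm_sq_grad q y"
proof -
  let ?F = "\<lambda>x::real^'n. \<Sum>i\<in>UNIV. \<bar>x $ i\<bar> powr q"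
  have nn: "0 \<le> y $ i" for i
    using y by (simp add: simplex_points_def)
  have "((\<lambda>x. \<bar>x $ i\<bar> powr q) has_derivative (\<lambda>h. h $ i * (q * (y $ i) powr (q - 1)))) (at y)" for i
    by (rule DERIV_compose_FDERIV [where f = "\<lambda>x. \<bar>x\<bar> powr q" and g = "\<lambda>x. x $ i"])
      (intro DERIV_abs_powr q nn bounded_linear_imp_has_derivative bounded_linear_vec_nth)+
  then have "(?F has_derivative (\<lambda>h. \<Sum>i\<in>UNIV. h $ i * (q * (y $ i) powr (q - 1)))) (at y)"
    by (intro derivative_intros)
  then have "GDERIV ?F y :> (\<chi> i. q * (y $ i) powr (q - 1))"
    by (simp add: gderiv_def inner_vec_def)
  moreover have "DERIV (\<lambda>s. s powr (2 / q)) (?F y) :> 2 / q * ?F y powr (2 / q - 1)"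
    using simplex_sum_powr_pos [OF y] by (intro has_real_derivative_powr)
  ultimately have "GDERIV (\<lambda>x. ?F x powr (2 / q)) y :>
      (2 / q * ?F y powr (2 / q - 1)) *\<^sub>R (\<chi> i. q * (y $ i) powr (q - 1))"
    by (rule GDERIV_DERIV_compose)
  also have "(2 / q * ?F y powr (2 / q - 1)) *\<^sub>R (\<chi> i. q * (y $ i) powr (q - 1)) = lq_norm_sq_grad q y"
    using q nn by (simp add: vec_eq_iff lq_norm_sq_grad_def)
  finally show ?thesis
    by (simp add: lq_norm_power2)
qed

text \<open>By Hoelder the gradient at y pairs with x to at most twice the product of the two norms,
  and with y to exactly twice the squared norm of y. So the divergence is at least the square of the
  difference of the norms. This covers every q > 1, including q \<ge> 2.\<close>

lemma lq_norm_sq_bregman_nonneg: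
  fixes x y :: "real^'n"
  assumes q: "1 < q" and x: "x \<in> simplex_points" and y: "y \<in> simplex_points"
  shows "0 \<le> (lq_norm q x)\<^sup>2 - (lq_norm q y)\<^sup>2 - (x - y) \<bullet> lq_norm_sq_grad q y"
proof -
  define A where "A = (\<Sum>i\<in>UNIV. \<bar>x $ i\<bar> powr q)"
  define B where "B = (\<Sum>i\<in>UNIV. \<bar>y $ i\<bar> powr q)"
  have pos: "A > 0" "B > 0"
    using x y by (auto simp: A_def B_def simplex_sum_powr_pos)
  have nn: "0 \<le> x $ i" "0 \<le> y $ i" for i
    using x y by (auto simp: simplex_points_def)
  have "(\<Sum>i\<in>UNIV. x $ i * y $ i powr (q - 1)) =
      (\<Sum>i\<in>UNIV. (\<bar>x $ i\<bar> powr q) powr (1 / q) * (\<bar>y $ i\<bar> powr q) powr (1 - 1 / q))"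
    using q nn by (simp add: powr_powr algebra_simps)
  also have "\<dots> \<le> A powr (1 / q) * B powr (1 - 1 / q)"
    unfolding A_def B_def using q by (intro Holder_sum) auto
  finally have le: "(\<Sum>i\<in>UNIV. x $ i * y $ i powr (q - 1)) \<le> A powr (1 / q) * B powr (1 - 1 / q)" .
  have "x \<bullet> lq_norm_sq_grad q y = 2 * B powr (2 / q - 1) * (\<Sum>i\<in>UNIV. x $ i * y $ i powr (q - 1))"
    using nn by (simp add: inner_vec_def lq_norm_sq_grad_def B_def sum_distrib_left mult.left_commute mult.assoc)
  also have "\<dots> \<le> 2 * B powr (2 / q - 1) * (A powr (1 / q) * B powr (1 - 1 / q))"
    using le by (intro mult_left_mono) auto
  also have "\<dots> = 2 * A powr (1 / q) * (B powr (2 / q - 1) * B powr (1 - 1 / q))"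
    by simp
  also have "B powr (2 / q - 1) * B powr (1 - 1 / q) = B powr (1 / q)"
    by (simp add: field_simps flip: powr_add)
  finally have xg: "x \<bullet> lq_norm_sq_grad q y \<le> 2 * A powr (1 / q) * B powr (1 / q)" .
  have "y \<bullet> lq_norm_sq_grad q y = 2 * B powr (2 / q - 1) * (\<Sum>i\<in>UNIV. y $ i * y $ i powr (q - 1))"
    using nn by (simp add: inner_vec_def lq_norm_sq_grad_def B_def sum_distrib_left mult.left_commute mult.assoc)
  also have "(\<Sum>i\<in>UNIV. y $ i * y $ i powr (q - 1)) = B"
    unfolding B_def using nn q by (intro sum.cong) (auto simp: powr_mult_base)
  also have "2 * B powr (2 / q - 1) * B = 2 * B powr (2 / q)"
    using pos by (simp add: powr_diff)
  finally have yg: "y \<bullet> lq_norm_sq_grad q y = 2 * B powr (2 / q)" .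
  have sq: "C powr (2 / q) = (C powr (1 / q))\<^sup>2" for C :: real
    by (simp add: power2_eq_square flip: powr_add)
  have "A powr (2 / q) + B powr (2 / q) - 2 * A powr (1 / q) * B powr (1 / q)
      = (A powr (1 / q) - B powr (1 / q))\<^sup>2"
    by (simp add: sq power2_diff)
  then have "0 \<le> A powr (2 / q) + B powr (2 / q) - 2 * A powr (1 / q) * B powr (1 / q)"
    by simp
  then show ?thesis
    using xg yg by (simp add: lq_norm_power2 inner_diff_left A_def B_def)
qed

text \<open>If the base vanishes at an interior point of the segment then a = b = 0, so no
  singularity of a negative power is ever met.\<close>

lemma DERIV_segment_powr:
  fixes a b :: real
  assumes "0 \<le> a" "0 \<le> b" "0 < t" "t < 1"
  shows "((\<lambda>t. (a + t * (b - a)) powr r) has_real_derivative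
           r * (a + t * (b - a)) powr (r - 1) * (b - a)) (at t)"
proof (cases "a = 0 \<and> b = 0")
  case False
  have "a + t * (b - a) = (1 - t) * a + t * b"
    by (simp add: algebra_simps)
  also have "\<dots> > 0"
    using assms False by (cases "a = 0") (auto intro: add_pos_nonneg)
  finally show ?thesis
    using DERIV_fun_powr [of "\<lambda>t. a + t * (b - a)" "b - a" t r]
    by (auto intro!: derivative_eq_intros)
qed simp

text \<open>Along the segment from y to x the squared norm \<phi> has second derivative at least 2
  (q - 1) \<open>D\<close>. Two monotonicity arguments integrate this bound, and the value of
  \<phi>' at 0 is the gradient term.\<close>

lemma lq_norm_sq_strongly_convex:
  fixes x y :: "real^'n"
  assumes q: "1 < q" "q < 2" and x: "x \<in> simplex_points" and y: "y \<in> simplex_points"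
  shows "(q - 1) * (lq_norm q (x - y))\<^sup>2
    \<le> (lq_norm q x)\<^sup>2 - (lq_norm q y)\<^sup>2 - (x - y) \<bullet> lq_norm_sq_grad q y"
proof -
  have nn: "0 \<le> x $ i" "0 \<le> y $ i" for i
    using x y by (auto simp: simplex_points_def)
  define z where "z i t = y $ i + t * (x $ i - y $ i)" for i and t :: real
  define F where "F t = (\<Sum>i\<in>UNIV. z i t powr q)" for t
  define G where "G t = (\<Sum>i\<in>UNIV. z i t powr (q - 1) * (x $ i - y $ i))" for t
  define H where "H t = (\<Sum>i\<in>UNIV. z i t powr (q - 2) * (x $ i - y $ i)\<^sup>2)" for t
  define D where "D = (lq_norm q (x - y))\<^sup>2"
  define \<phi> where "\<phi> t = F t powr (2 / q)" for t
  define \<phi>' where "\<phi>' t = 2 * F t powr (2 / q - 1) * G t" for t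
  have zeq: "z i t = (1 - t) * y $ i + t * x $ i" for i t
    by (simp add: z_def algebra_simps)
  have z0: "0 \<le> z i t" if "t \<in> {0..1}" for i t
    using that nn by (simp add: zeq)
  have F: "0 < F t" if t: "t \<in> {0..1}" for t
  proof -
    have "(\<Sum>i\<in>UNIV. z i t) = 1"
      using x y by (simp add: zeq sum.distrib simplex_points_def flip: sum_distrib_left)
    then obtain i where "z i t \<noteq> 0"
      by (metis (mono_tags, lifting) sum.neutral zero_neq_one)
    then show ?thesis
      unfolding F_def using z0 [OF t] by (intro sum_pos2 [of _ i]) auto
  qed
  have dF: "(F has_real_derivative q * G t) (at t)" if "0 < t" "t < 1" for t
  proof -
    have "(F has_real_derivative (\<Sum>i\<in>UNIV. q * z i t powr (q - 1) * (x $ i - y $ i))) (at t)"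
      unfolding F_def z_def using that nn by (intro DERIV_sum DERIV_segment_powr)
    then show ?thesis
      by (simp add: G_def sum_distrib_left mult.assoc)
  qed
  have dG: "(G has_real_derivative (q - 1) * H t) (at t)" if "0 < t" "t < 1" for t
  proof -
    have "((\<lambda>t. z i t powr (q - 1) * (x $ i - y $ i)) has_real_derivative
        ((q - 1) * z i t powr (q - 1 - 1) * (x $ i - y $ i)) * (x $ i - y $ i)) (at t)" for i
      unfolding z_def using that nn by (intro DERIV_cmult_right DERIV_segment_powr)
    then have "(G has_real_derivative
        (\<Sum>i\<in>UNIV. ((q - 1) * z i t powr (q - 1 - 1) * (x $ i - y $ i)) * (x $ i - y $ i))) (at t)"
      unfolding G_def by (rule DERIV_sum)
    also have "(\<Sum>i\<in>UNIV. ((q - 1) * z i t powr (q - 1 - 1) * (x $ i - y $ i)) * (x $ i - y $ i)) = (q - 1) * H t"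
      by (simp add: H_def sum_distrib_left mult.assoc power2_eq_square)
    finally show ?thesis .
  qed
  have d\<phi>: "(\<phi> has_real_derivative \<phi>' t) (at t)" if t: "0 < t" "t < 1" for t
    unfolding \<phi>_def
    using DERIV_fun_powr [OF dF [OF t], of "2 / q"] F [of t] t q by (simp add: \<phi>'_def mult.assoc)
  have d\<phi>': "\<exists>D'. (\<phi>' has_real_derivative D') (at t) \<and> 2 * (q - 1) * D \<le> D'" if t: "0 < t" "t < 1" for t
  proof (intro exI conjI)
    have Ft: "F t > 0"
      using F t by simp
    let ?D' = "2 * ((2 / q - 1) * F t powr (2 / q - 2) * (q * G t) * G t + F t powr (2 / q - 1) * ((q - 1) * H t))"
    have "((\<lambda>t. F t powr (2 / q - 1)) has_real_derivative (2 / q - 1) * F t powr (2 / q - 2) * (q * G t)) (at t)"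
      using DERIV_fun_powr [OF dF [OF t] Ft, of "2 / q - 1"] by simp
    from DERIV_cmult [OF DERIV_mult [OF this dG [OF t]], of 2]
    show "(\<phi>' has_real_derivative ?D') (at t)"
      unfolding \<phi>'_def by (simp add: algebra_simps)
    \<comment> \<open>The powers of \<open>z i t\<close> on the right cancel. The split prepares
      Hoelder with exponents q/2 and 1 - q/2, which bounds \<open>D\<close> by the part of the
      second derivative containing \<open>H t\<close>.\<close>
    have "(\<Sum>i\<in>UNIV. \<bar>(x - y) $ i\<bar> powr q) =
        (\<Sum>i\<in>UNIV. (z i t powr (q - 2) * (x $ i - y $ i)\<^sup>2) powr (q / 2) * (z i t powr q) powr (1 - q / 2))"
    proof (intro sum.cong refl)
      fix i
      show "\<bar>(x - y) $ i\<bar> powr q =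
          (z i t powr (q - 2) * (x $ i - y $ i)\<^sup>2) powr (q / 2) * (z i t powr q) powr (1 - q / 2)"
      proof (cases "z i t = 0")
        case True
        then have "x $ i = 0" "y $ i = 0"
          using nn t by (simp_all add: zeq add_nonneg_eq_0_iff)
        then show ?thesis
          by simp
      next
        case False
        then have "z i t > 0"
          using z0 [of t i] t by simp
        have "((x $ i - y $ i)\<^sup>2) powr (q / 2) = \<bar>x $ i - y $ i\<bar> powr q"
        proof -
          have "((x $ i - y $ i)\<^sup>2) powr (q / 2) = (\<bar>x $ i - y $ i\<bar> powr 2) powr (q / 2)"
            by simp
          then show ?thesis
            unfolding powr_powr by simp
        qed
        moreover have "(z i t powr (q - 2)) powr (q / 2) * (z i t powr q) powr (1 - q / 2) = 1"
        proof -
          have "(q - 2) * (q / 2) + q * (1 - q / 2) = 0"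
            by (simp add: field_simps)
          then show ?thesis
            unfolding powr_powr powr_add [symmetric] using \<open>z i t > 0\<close> by simp
        qed
        ultimately show ?thesis
          by (simp add: powr_mult mult_ac)
      qed
    qed
    also have "\<dots> \<le> H t powr (q / 2) * F t powr (1 - q / 2)"
      unfolding H_def F_def using q by (intro Holder_sum) auto
    finally have "(\<Sum>i\<in>UNIV. \<bar>(x - y) $ i\<bar> powr q) powr (2 / q)
        \<le> (H t powr (q / 2) * F t powr (1 - q / 2)) powr (2 / q)"
      using q by (intro powr_mono2) (auto intro: sum_nonneg)
    moreover have "H t \<ge> 0"
      unfolding H_def by (intro sum_nonneg) auto
    moreover have "(1 - q / 2) * (2 / q) = 2 / q - 1"
      using q by (simp add: field_simps)
    ultimately have "D \<le> F t powr (2 / q - 1) * H t"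
      using q by (simp add: D_def lq_norm_power2 powr_mult powr_powr mult.commute)
    then have "2 * (q - 1) * D \<le> 2 * (q - 1) * (F t powr (2 / q - 1) * H t)"
      using q by (intro mult_left_mono) auto
    \<comment> \<open>The term with the square of \<open>G t\<close> is nonnegative because q < 2
      makes 2/q - 1 positive.\<close>
    also have "\<dots> \<le> 2 * (q - 1) * (F t powr (2 / q - 1) * H t)
        + 2 * ((2 / q - 1) * F t powr (2 / q - 2) * q) * (G t)\<^sup>2"
      using q by simp
    also have "\<dots> = ?D'"
      by (simp add: power2_eq_square algebra_simps)
    finally show "2 * (q - 1) * D \<le> ?D'" .
  qed
  \<comment> \<open>The derivatives above hold only for 0 < t < 1, so the endpoints are reached by
    continuity. \<phi> and \<phi>' involve \<open>z i t\<close> only to the powers q and q - 1, both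
    positive, so zeros of the base do no harm.\<close>
  have cz: "continuous_on {0..1} (\<lambda>t. z i t powr r)" if "r > 0" for i r
    using that z0 unfolding z_def by (intro continuous_on_powr' continuous_intros) auto
  have cF: "continuous_on {0..1} F"
    unfolding F_def using q by (intro continuous_on_sum cz) auto
  have cFr: "continuous_on {0..1} (\<lambda>t. F t powr r)" for r
    using F by (intro continuous_on_powr cF continuous_intros) force
  have c\<phi>': "continuous_on {0..1} \<phi>'"
    unfolding \<phi>'_def G_def using q by (intro continuous_intros cFr cz) auto
  have mono: "\<phi>' 0 + 2 * (q - 1) * D * t \<le> \<phi>' t" if t: "0 \<le> t" "t \<le> 1" for t
  proof -
    have "\<phi>' 0 - 2 * (q - 1) * D * 0 \<le> \<phi>' t - 2 * (q - 1) * D * t"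
    proof (rule DERIV_nonneg_imp_increasing_open [where f = "\<lambda>t. \<phi>' t - 2 * (q - 1) * D * t"])
      fix s assume "0 < s" "s < t"
      then obtain D' where "(\<phi>' has_real_derivative D') (at s)" "2 * (q - 1) * D \<le> D'"
        using d\<phi>' [of s] t by auto
      then show "\<exists>y. ((\<lambda>t. \<phi>' t - 2 * (q - 1) * D * t) has_real_derivative y) (at s) \<and> 0 \<le> y"
        by (intro exI [of _ "D' - 2 * (q - 1) * D"]) (auto intro!: derivative_eq_intros)
    next
      show "continuous_on {0..t} (\<lambda>t. \<phi>' t - 2 * (q - 1) * D * t)"
        using t by (intro continuous_intros continuous_on_subset [OF c\<phi>']) auto
    qed (use t in simp)
    then show ?thesis
      by simp
  qed
  \<comment> \<open>Second integration: \<phi> minus its quadratic lower bound is nondecreasing on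
    the unit interval.\<close>
  have "\<phi> 0 - (\<phi>' 0 * 0 + (q - 1) * D * 0\<^sup>2) \<le> \<phi> 1 - (\<phi>' 0 * 1 + (q - 1) * D * 1\<^sup>2)"
  proof (rule DERIV_nonneg_imp_increasing_open [where f = "\<lambda>t. \<phi> t - (\<phi>' 0 * t + (q - 1) * D * t\<^sup>2)"])
    fix s :: real assume s: "0 < s" "s < 1"
    show "\<exists>y. ((\<lambda>t. \<phi> t - (\<phi>' 0 * t + (q - 1) * D * t\<^sup>2)) has_real_derivative y) (at s) \<and> 0 \<le> y"
      using mono [of s] s d\<phi> [OF s]
      by (intro exI [of _ "\<phi>' s - (\<phi>' 0 + 2 * (q - 1) * D * s)"]) (auto intro!: derivative_eq_intros)
  next
    show "continuous_on {0..1} (\<lambda>t. \<phi> t - (\<phi>' 0 * t + (q - 1) * D * t\<^sup>2))"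
      unfolding \<phi>_def by (intro continuous_intros cFr)
  qed simp
  moreover have "\<phi> 0 = (lq_norm q y)\<^sup>2" "\<phi> 1 = (lq_norm q x)\<^sup>2"
    using nn by (simp_all add: \<phi>_def F_def z_def lq_norm_power2)
  moreover have "\<phi>' 0 = (x - y) \<bullet> lq_norm_sq_grad q y"
    using nn by (simp add: \<phi>'_def F_def G_def z_def lq_norm_sq_grad_def inner_vec_def
        sum_distrib_left mult_ac)
  ultimately show ?thesis
    by (simp add: D_def)
qed

section \<open>Online Mirror Descent\<close>

lemma gradient_eq:
  assumes "GDERIV f x :> g"
  shows "gradient f x = g"
  unfolding gradient_def
proof (rule the_equality)
  fix g' assume "GDERIV f x :> g'"
  then have "(\<lambda>h. h \<bullet> g') = (\<lambda>h. h \<bullet> g)"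
    using assms unfolding gderiv_def by (rule has_derivative_unique)
  then have "(g' - g) \<bullet> g' = (g' - g) \<bullet> g"
    by (rule fun_cong)
  then show "g' = g"
    by (metis eq_iff_diff_eq_0 inner_diff_right inner_eq_zero_iff)
qed (rule assms)

lemma convex_simplex_points: "convex (simplex_points :: (real^'n) set)"
proof (rule convexI)
  fix x y :: "real^'n" and a b :: real
  assume *: "x \<in> simplex_points" "y \<in> simplex_points" and ab: "0 \<le> a" "0 \<le> b" "a + b = 1"
  have "a * x $ i + b * y $ i \<le> 1" for i
    using * ab by (intro convex_bound_le) (auto simp: simplex_points_def)
  then show "a *\<^sub>R x + b *\<^sub>R y \<in> simplex_points"
    using * ab by (auto simp: simplex_points_def sum.distrib simp flip: sum_distrib_left)
qed

text \<open>If the directional derivative towards u were negative, a short step from w towards u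
  would decrease f, and convexity keeps that step inside \<open>S\<close>.\<close>

lemma is_arg_min_first_order:
  fixes f :: "'a::real_inner \<Rightarrow> real"
  assumes S: "convex S" and g: "GDERIV f w :> g"
    and w: "is_arg_min f (\<lambda>x. x \<in> S) w" and u: "u \<in> S"
  shows "0 \<le> (u - w) \<bullet> g"
proof (rule ccontr)
  assume neg: "\<not> ?thesis"
  let ?\<phi> = "\<lambda>t. f (w + t *\<^sub>R (u - w))"
  have "(f has_derivative (\<lambda>h. h \<bullet> g)) (at (w + 0 *\<^sub>R (u - w)))"
    using g by (simp add: gderiv_def)
  then have "(?\<phi> has_derivative (\<lambda>t. (t *\<^sub>R (u - w)) \<bullet> g)) (at 0)"
    by (rule has_derivative_compose [rotated]) (auto intro!: derivative_eq_intros)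
  then have "(?\<phi> has_real_derivative (u - w) \<bullet> g) (at 0)"
    by (simp add: has_field_derivative_def mult_commute_abs)
  then obtain d where d: "d > 0" "\<And>h. 0 < h \<Longrightarrow> h < d \<Longrightarrow> ?\<phi> 0 > ?\<phi> (0 + h)"
    using DERIV_neg_dec_right [of ?\<phi> "(u - w) \<bullet> g" 0] neg by force
  define h where "h = min 1 (d / 2)"
  have h: "0 < h" "h < d" "h \<le> 1"
    using d(1) by (auto simp: h_def)
  have "w + h *\<^sub>R (u - w) = (1 - h) *\<^sub>R w + h *\<^sub>R u"
    by (simp add: algebra_simps)
  also have "\<dots> \<in> S"
    using S w u h by (intro convexD) (auto simp: is_arg_min_def)
  finally show False
    using d(2) [OF h(1,2)] w by (auto simp: is_arg_min_def)
qed

text \<open>In the last round the one-step estimate is applied with the comparator u itself, because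
  a run of T rounds provides no point w (T + 1).\<close>

lemma omd_linearized_regret:
  fixes R :: "real^'n \<Rightarrow> real" and g :: "real^'n \<Rightarrow> real^'n"
  assumes grad: "\<And>x. x \<in> simplex_points \<Longrightarrow> GDERIV R x :> g x"
    and run: "omd_run \<Omega> R \<eta> T l w" and T: "1 \<le> T"
    and stab: "\<And>t x v. t \<in> {1..T} \<Longrightarrow> x \<in> simplex_points \<Longrightarrow> v \<in> simplex_points \<Longrightarrow>
      \<eta> * (l t \<bullet> (x - v)) \<le> R v - R x - (v - x) \<bullet> g x + \<kappa>"
    and u: "u \<in> simplex_points"
  shows "\<eta> * (\<Sum>t=1..T. l t \<bullet> (w t - u)) \<le> R u - R (w 1) + real T * \<kappa>"
proof -
  have first: "is_arg_min R (\<lambda>x. x \<in> simplex_points) (w 1)"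
    using run by (simp add: omd_run_def)
  have step: "\<exists>y. gradient R y = gradient R (w t) - \<eta> *\<^sub>R l t \<and>
      is_arg_min (\<lambda>x. bregman R x y) (\<lambda>x. x \<in> simplex_points) (w (Suc t))" if "t \<in> {1..<T}" for t
    using run that by (auto simp: omd_run_def)
  have w: "w t \<in> simplex_points" if "t \<in> {1..T}" for t
  proof (cases "t = 1")
    case False
    then have "t - 1 \<in> {1..<T}" "Suc (t - 1) = t"
      using that by auto
    then show ?thesis
      using step [of "t - 1"] by (auto simp: is_arg_min_def)
  qed (use first in \<open>simp add: is_arg_min_def\<close>)
  \<comment> \<open>The Bregman divergence of the comparator from the current play, which is the
    telescoping potential.\<close>
  define V where "V t = R u - R (w t) - (u - w t) \<bullet> g (w t)" for t
  have round: "\<eta> * (l t \<bullet> (w t - u)) \<le> \<kappa> + V t - V (Suc t)" if t: "t \<in> {1..<T}" for t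
  proof -
    have ws: "w t \<in> simplex_points" "w (Suc t) \<in> simplex_points"
      using t w by auto
    obtain y where y: "gradient R y = g (w t) - \<eta> *\<^sub>R l t"
      and min: "is_arg_min (\<lambda>x. bregman R x y) (\<lambda>x. x \<in> simplex_points) (w (Suc t))"
      using step [OF t] gradient_eq [OF grad [OF ws(1)]] by auto
    \<comment> \<open>The gradient at y enters as a constant vector; R is differentiated only at the
      new play, which lies in the simplex.\<close>
    have "GDERIV (\<lambda>x. bregman R x y) (w (Suc t)) :> g (w (Suc t)) - gradient R y"
      using grad [OF ws(2)] unfolding gderiv_def bregman_def
      by (auto intro!: derivative_eq_intros simp: inner_diff_right)
    then have "0 \<le> (u - w (Suc t)) \<bullet> (g (w (Suc t)) - gradient R y)"
      using is_arg_min_first_order [OF convex_simplex_points _ min u] by blast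
    then have "0 \<le> (u - w (Suc t)) \<bullet> g (w (Suc t)) - (u - w (Suc t)) \<bullet> g (w t)
        + \<eta> * (l t \<bullet> (u - w (Suc t)))"
      by (simp add: y inner_diff_right inner_commute [of _ "l t"])
    \<comment> \<open>Stability is applied between consecutive plays. Adding it to the optimality
      inequality cancels the divergence between them, as in the three-point identity.\<close>
    moreover have "\<eta> * (l t \<bullet> (w t - w (Suc t)))
        \<le> R (w (Suc t)) - R (w t) - (w (Suc t) - w t) \<bullet> g (w t) + \<kappa>"
      using stab [of t] t ws by simp
    ultimately show ?thesis
      by (simp add: V_def inner_diff_left inner_diff_right algebra_simps)
  qed
  have "(\<Sum>t=1..<n. \<eta> * (l t \<bullet> (w t - u))) \<le> (real n - 1) * \<kappa> + V 1 - V n" if "1 \<le> n" "n \<le> T" for n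
    using that
  proof (induction n rule: dec_induct)
    case (step n)
    then show ?case
      using round [of n] by (simp add: algebra_simps)
  qed simp
  from this [of T] T have "(\<Sum>t=1..<T. \<eta> * (l t \<bullet> (w t - u))) \<le> (real T - 1) * \<kappa> + V 1 - V T"
    by simp
  moreover have "\<eta> * (l T \<bullet> (w T - u)) \<le> V T + \<kappa>"
    using stab [of T "w T" u] w [of T] u T by (simp add: V_def)
  \<comment> \<open>The first play minimises R on the simplex, so the linear term of
    \<open>V 1\<close> has a favourable sign.\<close>
  moreover have "V 1 \<le> R u - R (w 1)"
    using is_arg_min_first_order [OF convex_simplex_points grad first u] w [of 1] T by (simp add: V_def)
  moreover have "(\<Sum>t=1..T. \<eta> * (l t \<bullet> (w t - u))) =
      (\<Sum>t=1..<T. \<eta> * (l t \<bullet> (w t - u))) + \<eta> * (l T \<bullet> (w T - u))"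
    using T by (simp add: sum.last_plus atLeastLessThanSuc_atLeastAtMost [symmetric])
  ultimately show ?thesis
    by (simp add: sum_distrib_left algebra_simps)
qed

section \<open>The regularizer with the matrix H\<close>

lemma H_matrix_mult_vec:
  "H_matrix U M *v x = x + U *v (M *v (transpose U *v x))"
  by (simp add: H_matrix_def matrix_vector_mult_add_rdistrib matrix_vector_mul_assoc matrix_mul_assoc
      del: transpose_matrix_vector)

lemma inner_H_matrix:
  "y \<bullet> (H_matrix U M *v x) = y \<bullet> x + (transpose U *v y) \<bullet> (M *v (transpose U *v x))"
  by (simp add: H_matrix_mult_vec inner_add_right dot_lmul_matrix [symmetric] transpose_matrix_vector)

lemma inner_H_matrix_commute:
  assumes "pos_def M"
  shows "y \<bullet> (H_matrix U M *v x) = x \<bullet> (H_matrix U M *v y)"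
  using assms inner_matrix_symmetric [of M]
  by (simp add: inner_H_matrix inner_commute pos_def_def)

lemma GDERIV_H_matrix_form:
  assumes "pos_def M"
  shows "GDERIV (\<lambda>x. x \<bullet> (H_matrix U M *v x)) x :> 2 *\<^sub>R (H_matrix U M *v x)"
proof -
  have "((\<lambda>x. x \<bullet> (H_matrix U M *v x)) has_derivative
      (\<lambda>h. x \<bullet> (H_matrix U M *v h) + h \<bullet> (H_matrix U M *v x))) (at x)"
    by (intro has_derivative_inner has_derivative_ident bounded_linear_imp_has_derivative
        matrix_vector_mul_bounded_linear)
  moreover have "(\<lambda>h. x \<bullet> (H_matrix U M *v h) + h \<bullet> (H_matrix U M *v x)) =
      (\<lambda>h. h \<bullet> (2 *\<^sub>R (H_matrix U M *v x)))"
    using inner_H_matrix_commute [OF assms, of _ U x] by auto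
  ultimately show ?thesis
    unfolding gderiv_def by simp
qed

text \<open>Entries in [0,1] put a preimage of the loss into the body, and the ellipsoid contains
  the body.\<close>

lemma subspace_loss_preimage:
  assumes "loewner_john_matrix U M" and "l \<in> subspace_losses U"
  obtains v where "l = U *v v" "v \<bullet> (matrix_inv M *v v) \<le> 1"
proof -
  obtain v where l: "l = U *v v" "\<And>i. 0 \<le> l $ i \<and> l $ i \<le> 1"
    using assms(2) by (auto simp: subspace_losses_def)
  have "infnorm l \<le> 1"
    unfolding infnorm_cart by (rule cSup_least) (use l(2) in auto)
  then have "v \<in> sup_ball U"
    by (simp add: sup_ball_def l(1))
  then have "v \<bullet> (matrix_inv M *v v) \<le> 1"
    using assms(1) by (auto simp: loewner_john_matrix_def loewner_john_ellipsoid_def)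
  with l(1) that show ?thesis
    by blast
qed

text \<open>Young's inequality for the dual forms of M and its inverse, obtained by completing the
  square: the M-form is nonnegative at z - (\<eta>/2) \<open>P\<close>, where M sends
  \<open>P\<close> to the preimage v.\<close>

lemma subspace_loss_le:
  fixes U :: "real^'d^'n"
  assumes LJ: "loewner_john_matrix U M" and l: "l \<in> subspace_losses U"
  shows "\<eta> * (l \<bullet> x) \<le> \<eta>\<^sup>2 / 4 + (transpose U *v x) \<bullet> (M *v (transpose U *v x))"
proof -
  obtain v where v: "l = U *v v" "v \<bullet> (matrix_inv M *v v) \<le> 1"
    using subspace_loss_preimage [OF LJ l] .
  have M: "pos_def M"
    using LJ by (simp add: loewner_john_matrix_def)
  define z where "z = transpose U *v x"
  define P where "P = matrix_inv M *v v"
  have MP: "M *v P = v"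
    by (simp add: P_def pos_def_inverse_vector [OF M])
  have "P \<bullet> (M *v z) = z \<bullet> (M *v P)"
    using M by (intro inner_matrix_symmetric) (simp add: pos_def_def)
  then have Pz: "P \<bullet> (M *v z) = z \<bullet> v"
    by (simp add: MP)
  have "0 \<le> (z - (\<eta> / 2) *\<^sub>R P) \<bullet> (M *v (z - (\<eta> / 2) *\<^sub>R P))"
    by (rule pos_def_nonneg [OF M])
  also have "\<dots> = z \<bullet> (M *v z) - \<eta> * (z \<bullet> v) + \<eta>\<^sup>2 / 4 * (v \<bullet> P)"
    by (simp add: matrix_vector_mult_diff_distrib matrix_vector_mult_scaleR MP inner_diff_left
        inner_diff_right Pz inner_commute [of P v] power2_eq_square field_simps)
  also have "\<eta>\<^sup>2 / 4 * (v \<bullet> P) \<le> \<eta>\<^sup>2 / 4 * 1"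
    using v(2) by (intro mult_left_mono) (auto simp: P_def)
  finally have "\<eta> * (z \<bullet> v) \<le> \<eta>\<^sup>2 / 4 + z \<bullet> (M *v z)"
    by simp
  moreover have "l \<bullet> x = z \<bullet> v"
    unfolding z_def v(1) by (metis dot_lmul_matrix inner_commute transpose_matrix_vector)
  ultimately show ?thesis
    by (simp add: z_def)
qed

text \<open>Only s coordinates contribute, each with weight at most 1. Hoelder against the constant
  1 on the support produces the power of s.\<close>

lemma sparse_loss_le:
  fixes x :: "real^'n"
  assumes q: "1 < q" and l: "l \<in> sparse_losses s"
  shows "l \<bullet> x \<le> real s powr (1 - 1 / q) * lq_norm q x"
proof -
  define S where "S = {i. l $ i \<noteq> 0}"
  have S: "card S = s" "finite S"
    using l by (simp_all add: S_def sparse_losses_def l0_norm_def)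
  have "l \<bullet> x = (\<Sum>i\<in>S. l $ i * x $ i)"
    unfolding inner_vec_def by (rule sum.mono_neutral_cong_right) (auto simp: S_def)
  also have "\<dots> \<le> (\<Sum>i\<in>S. 1 * \<bar>x $ i\<bar>)"
  proof (rule sum_mono)
    fix i
    have "l $ i * x $ i \<le> l $ i * \<bar>x $ i\<bar>"
      using l by (intro mult_left_mono) (auto simp: sparse_losses_def)
    also have "\<dots> \<le> 1 * \<bar>x $ i\<bar>"
      using l by (intro mult_right_mono) (auto simp: sparse_losses_def)
    finally show "l $ i * x $ i \<le> 1 * \<bar>x $ i\<bar>" .
  qed
  also have "\<dots> = (\<Sum>i\<in>S. (\<bar>x $ i\<bar> powr q) powr (1 / q) * 1 powr (1 - 1 / q))"
    using q by (simp add: powr_powr)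
  also have "\<dots> \<le> (\<Sum>i\<in>S. \<bar>x $ i\<bar> powr q) powr (1 / q) * (\<Sum>i\<in>S. 1) powr (1 - 1 / q)"
    using q S by (intro Holder_sum) auto
  also have "\<dots> \<le> lq_norm q x * real s powr (1 - 1 / q)"
    unfolding lq_norm_def using q S
    by (intro mult_mono powr_mono2 sum_mono2) (auto intro: sum_nonneg)
  finally show ?thesis
    by (simp add: mult.commute)
qed

text \<open>The transpose of U sends the vertex to the i-th row of U, and membership in
  \<open>sup_ball U\<close> bounds the i-th coordinate of \<open>U *v v\<close>. This is the slab
  condition of the width bound. The identity part of H and the q-norm contribute 1 each.\<close>

lemma regularizer_vertex_le:
  fixes U :: "real^'d^'n"
  assumes LJ: "loewner_john_matrix U M" and q: "q > 1"
  shows "axis i 1 \<bullet> (H_matrix U M *v axis i 1) + (lq_norm q (axis i 1 :: real^'n))\<^sup>2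
    \<le> 4 * real CARD('d) + 2"
proof -
  let ?e = "axis i (1::real) :: real^'n"
  have "(transpose U *v ?e) \<bullet> (M *v (transpose U *v ?e)) \<le> 4 * real CARD('d)"
  proof (rule loewner_john_width)
    show "pos_def M" "loewner_john_ellipsoid (sup_ball U) {v. v \<bullet> (matrix_inv M *v v) \<le> 1}"
      using LJ by (simp_all add: loewner_john_matrix_def)
    fix v assume v: "v \<in> sup_ball U"
    have "(transpose U *v ?e) \<bullet> v = ?e \<bullet> (U *v v)"
      by (metis dot_lmul_matrix transpose_matrix_vector)
    also have "\<dots> = (U *v v) $ i"
      by (simp add: inner_axis')
    finally show "\<bar>(transpose U *v ?e) \<bullet> v\<bar> \<le> 1"
      using v component_le_infnorm_cart [of "U *v v" i] by (simp add: sup_ball_def)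
  qed
  moreover have "lq_norm q ?e = 1"
  proof -
    have "(\<Sum>j\<in>UNIV. \<bar>?e $ j\<bar> powr q) = (\<Sum>j\<in>UNIV. if j = i then 1 else 0)"
      by (intro sum.cong) (auto simp: axis_def)
    then show ?thesis
      by (simp add: lq_norm_def)
  qed
  ultimately show ?thesis
    by (simp add: inner_H_matrix inner_axis_axis)
qed

text \<open>For s = 1 the exponent q exceeds 2, where the squared q-norm is not strongly convex; then
  the identity part of the matrix H pays for the sparse loss.\<close>

lemma omd_stability:
  fixes U :: "real^'d^'n" and x u :: "real^'n"
  assumes LJ: "loewner_john_matrix U M"
    and s: "1 \<le> s" and p: "p = 2 * ln (real s + 1)" and q: "q = p / (p - 1)"
    and l: "l \<in> subspace_losses U + sparse_losses s"
    and x: "x \<in> simplex_points" and u: "u \<in> simplex_points"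
    and R: "R = (\<lambda>x. x \<bullet> (H_matrix U M *v x) + (lq_norm q x)\<^sup>2)"
    and g: "g = (\<lambda>x. 2 *\<^sub>R (H_matrix U M *v x) + lq_norm_sq_grad q x)"
    and \<eta>: "0 \<le> \<eta>"
  shows "\<eta> * (l \<bullet> (x - u)) \<le> R u - R x - (u - x) \<bullet> g x + \<eta>\<^sup>2 * (1 + 3 * (p - 1)) / 4"
proof -
  have M: "pos_def M"
    using LJ by (simp add: loewner_john_matrix_def)
  obtain l1 l2 where l12: "l = l1 + l2" "l1 \<in> subspace_losses U" "l2 \<in> sparse_losses s"
    using l by (rule set_plus_elim)
  define \<delta> where "\<delta> = x - u"
  define Z where "Z = (transpose U *v \<delta>) \<bullet> (M *v (transpose U *v \<delta>))"
  define N where "N = (lq_norm q u)\<^sup>2 - (lq_norm q x)\<^sup>2 - (u - x) \<bullet> lq_norm_sq_grad q x"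
  have "ln (2::real) \<le> ln (real s + 1)"
    using s by simp
  \<comment> \<open>ln 2 \<ge> 2/3 gives p \<ge> 4/3. Hence 3 (p - 1) is at least 1, which the case
    s = 1 relies on.\<close>
  then have p1: "1 / 3 \<le> p - 1"
    using ln2_ge_two_thirds p by linarith
  then have q1: "q > 1"
    by (simp add: q less_divide_eq)
  have "u \<bullet> (H_matrix U M *v u) - x \<bullet> (H_matrix U M *v x) - (u - x) \<bullet> (2 *\<^sub>R (H_matrix U M *v x))
      = \<delta> \<bullet> (H_matrix U M *v \<delta>)"
    using inner_H_matrix_commute [OF M, of x U u]
    by (simp add: \<delta>_def matrix_vector_mult_diff_distrib inner_diff_left inner_diff_right)
  then have breg: "R u - R x - (u - x) \<bullet> g x = \<delta> \<bullet> \<delta> + Z + N"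
    by (simp add: R g N_def Z_def inner_add_right inner_H_matrix)
  have l1: "\<eta> * (l1 \<bullet> \<delta>) \<le> \<eta>\<^sup>2 / 4 + Z"
    unfolding Z_def by (rule subspace_loss_le [OF LJ l12(2)])
  have young: "\<eta> * (a * b) \<le> \<eta>\<^sup>2 * a\<^sup>2 / (4 * c) + c * b\<^sup>2" if "c > 0" for a b c :: real
  proof -
    have "0 \<le> (\<eta> * a / 2 - c * b)\<^sup>2 / c"
      using that by simp
    also have "\<dots> = \<eta>\<^sup>2 * a\<^sup>2 / (4 * c) + c * b\<^sup>2 - \<eta> * (a * b)"
      using that by (simp add: power2_eq_square field_simps)
    finally show ?thesis
      by simp
  qed
  have l2: "\<eta> * (l2 \<bullet> \<delta>) \<le> \<eta>\<^sup>2 * (3 * (p - 1)) / 4 + \<delta> \<bullet> \<delta> + N"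
  proof (cases "s = 1")
    case True
    \<comment> \<open>Hoelder is used with exponent 2 instead of q: the factor from s is 1, and the
      squared 2-norm is what the identity part of H supplies.\<close>
    have "l2 \<bullet> \<delta> \<le> lq_norm 2 \<delta>"
      using sparse_loss_le [OF _ l12(3), of 2 \<delta>] True by simp
    then have "\<eta> * (l2 \<bullet> \<delta>) \<le> \<eta> * (1 * lq_norm 2 \<delta>)"
      using \<eta> by (simp add: mult_left_mono)
    also have "\<dots> \<le> \<eta>\<^sup>2 * 1\<^sup>2 / (4 * 1) + 1 * (lq_norm 2 \<delta>)\<^sup>2"
      by (rule young) simp
    also have "(lq_norm 2 \<delta>)\<^sup>2 = \<delta> \<bullet> \<delta>"
      by (simp add: lq_norm_power2 sum_nonneg) (simp add: inner_vec_def power2_eq_square)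
    also have "\<eta>\<^sup>2 * 1\<^sup>2 / (4 * 1) \<le> \<eta>\<^sup>2 * (3 * (p - 1)) / 4"
      using p1 by (simp add: mult_left_le mult_le_cancel_left1)
    finally show ?thesis
      using lq_norm_sq_bregman_nonneg [OF q1 u x] by (simp add: N_def)
  next
    case False
    \<comment> \<open>For s \<ge> 2, e < 3 \<le> s + 1 makes the logarithm exceed 1, so p > 2 and q
      < 2, the range of strong convexity.\<close>
    have "exp 1 < (3::real)"
      using e_less_272 by simp
    also have "3 \<le> real s + 1"
      using False s by simp
    finally have "exp 1 < exp (ln (real s + 1))"
      by simp
    then have s1: "1 < ln (real s + 1)"
      by (simp only: exp_less_cancel_iff)
    have q2: "q < 2"
      using s1 by (simp add: q p divide_less_eq)
    have pq: "1 - 1 / q = 1 / p" "q - 1 = 1 / (p - 1)"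
      using p1 by (simp_all add: q field_simps)
    define a where "a = real s powr (1 / p)"
    \<comment> \<open>The choice of p turns s^(2/p) into exp (ln s / ln (s + 1)), whose exponent is
      at most 1.\<close>
    have "a\<^sup>2 = exp (ln (real s) / ln (real s + 1))"
      using s s1 by (simp add: a_def powr_def p exp_double [symmetric])
    also have "\<dots> \<le> exp 1"
      using s s1 by simp
    finally have a: "a\<^sup>2 \<le> 3"
      using e_less_272 by simp
    have "\<eta> * (l2 \<bullet> \<delta>) \<le> \<eta> * (a * lq_norm q \<delta>)"
      using sparse_loss_le [OF q1 l12(3), of \<delta>] \<eta> by (simp add: pq a_def mult_left_mono)
    also have "\<dots> \<le> \<eta>\<^sup>2 * a\<^sup>2 / (4 * (q - 1)) + (q - 1) * (lq_norm q \<delta>)\<^sup>2"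
      by (rule young) (use q1 in simp)
    also have "lq_norm q \<delta> = lq_norm q (u - x)"
      by (simp add: lq_norm_def \<delta>_def abs_minus_commute)
    also have "(q - 1) * (lq_norm q (u - x))\<^sup>2 \<le> N"
      unfolding N_def by (rule lq_norm_sq_strongly_convex [OF q1 q2 u x])
    also have "\<eta>\<^sup>2 * a\<^sup>2 / (4 * (q - 1)) = \<eta>\<^sup>2 * (a\<^sup>2 * (p - 1)) / 4"
      by (simp add: pq)
    also have "\<dots> \<le> \<eta>\<^sup>2 * (3 * (p - 1)) / 4"
      using a p1 by (intro divide_right_mono mult_left_mono mult_right_mono) auto
    finally show ?thesis
      using inner_ge_zero [of \<delta>] by linarith
  qed
  have "\<eta> * (l \<bullet> (x - u)) = \<eta> * (l1 \<bullet> \<delta>) + \<eta> * (l2 \<bullet> \<delta>)"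
    by (simp add: l12 \<delta>_def inner_add_left distrib_left)
  also have "\<dots> \<le> (\<eta>\<^sup>2 / 4 + Z) + (\<eta>\<^sup>2 * (3 * (p - 1)) / 4 + \<delta> \<bullet> \<delta> + N)"
    using l1 l2 by (rule add_mono)
  finally show ?thesis
    unfolding breg by (simp add: field_simps)
qed

section \<open>Tuning the learning rate and the final regret bound\<close>

theorem corollary12:
  fixes U :: "real^'d^'n" and M :: "real^'d^'d"
    and s T :: nat and p q \<eta> :: real
    and l w :: "nat \<Rightarrow> real^'n"
  assumes "1 \<le> CARD('d)" and "real CARD('d) \<le> ln (real CARD('n))"
    and "rank U = CARD('d)"
    and "loewner_john_matrix U M"
    and "1 \<le> s" and "s \<le> CARD('n)"
    and "1 \<le> T"
    and "p = 2 * ln (real s + 1)" and "q = p / (p - 1)"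
    and "\<eta> = sqrt ((16 * real CARD('d) + 1) / ((2 * ln (real s + 1) - 1) * real T))"
    and "\<forall>t\<in>{1..T}. l t \<in> subspace_losses U + sparse_losses s"
    and "omd_run UNIV (\<lambda>x. x \<bullet> (H_matrix U M *v x) + (lq_norm q x)\<^sup>2) \<eta> T l w"
  shows "regret T l w \<le> 2 * sqrt (2 * (16 * real CARD('d) + 1) * ln (real s + 1) * real T)"
proof -
  define R where "R = (\<lambda>x. x \<bullet> (H_matrix U M *v x) + (lq_norm q x)\<^sup>2)"
  define g where "g = (\<lambda>x. 2 *\<^sub>R (H_matrix U M *v x) + lq_norm_sq_grad q x)"
  define D where "D = 16 * real CARD('d) + 1"
  define \<kappa> where "\<kappa> = \<eta>\<^sup>2 * (1 + 3 * (p - 1)) / 4"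
  note LJ = assms(4)
  have M: "pos_def M"
    using LJ by (simp add: loewner_john_matrix_def)
  have "ln (2::real) \<le> ln (real s + 1)"
    using assms(5) by simp
  then have p1: "1 / 3 \<le> p - 1"
    using ln2_ge_two_thirds assms(8) by linarith
  have q1: "q > 1"
    using p1 by (simp add: assms(9) less_divide_eq)
  have d: "1 \<le> real CARD('d)"
    using assms(1) by simp
  \<comment> \<open>This absorbs the vertex bound 4d + 2 into half of \<open>D\<close> = 16d +
    1.\<close>
  have "4 * c + 2 \<le> (16 * c + 1) / 2" if "1 \<le> c" for c :: real
    using that by simp
  from this [OF d] have D: "D > 0" "4 * real CARD('d) + 2 \<le> D / 2"
    by (simp_all add: D_def add_nonneg_pos)
  have T: "real T \<ge> 1"
    using assms(7) by simp
  have \<eta>: "\<eta> = sqrt (D / ((p - 1) * real T))"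
    by (simp add: assms(10) D_def assms(8))
  have \<eta>0: "\<eta> > 0"
    unfolding \<eta> using D p1 T by simp
  have \<eta>2: "\<eta>\<^sup>2 = D / ((p - 1) * real T)"
    unfolding \<eta> using D p1 T by simp

  \<comment> \<open>The minimum is attained by some expert i, and the vertex of i serves as the
    comparator.\<close>
  have "(MIN i\<in>UNIV. \<Sum>t=1..T. l t $ i) \<in> range (\<lambda>i. \<Sum>t=1..T. l t $ i)"
    by (intro Min_in) auto
  then obtain i where i: "(MIN i\<in>UNIV. \<Sum>t=1..T. l t $ i) = (\<Sum>t=1..T. l t $ i)"
    by blast
  define u where "u = (axis i 1 :: real^'n)"
  have u: "u \<in> simplex_points"
    by (auto simp: simplex_points_def u_def axis_def)
  have "regret T l w = (\<Sum>t=1..T. l t \<bullet> (w t - u))"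
    unfolding regret_def i sum_subtractf [symmetric]
    by (intro sum.cong) (auto simp: inner_diff_right inner_commute [of "w _"] u_def inner_axis)
  moreover have "\<eta> * (\<Sum>t=1..T. l t \<bullet> (w t - u)) \<le> R u - R (w 1) + real T * \<kappa>"
  proof (rule omd_linearized_regret [where g = g])
    show "omd_run UNIV R \<eta> T l w"
      using assms(12) by (simp add: R_def)
    fix x :: "real^'n" assume x: "x \<in> simplex_points"
    then show "GDERIV R x :> g x"
      unfolding R_def g_def
      by (intro GDERIV_add GDERIV_H_matrix_form M GDERIV_lq_norm_sq q1)
    fix t and v :: "real^'n" assume "t \<in> {1..T}" and v: "v \<in> simplex_points"
    then have "l t \<in> subspace_losses U + sparse_losses s"
      using assms(11) by blast
    then show "\<eta> * (l t \<bullet> (x - v)) \<le> R v - R x - (v - x) \<bullet> g x + \<kappa>"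
      unfolding \<kappa>_def using \<eta>0
      by (intro omd_stability [OF LJ assms(5) assms(8) assms(9) _ x v R_def g_def]) auto
  qed (use assms u in auto)
  moreover have "R u \<le> D / 2"
    using regularizer_vertex_le [OF LJ q1, of i] D by (simp add: R_def u_def)
  moreover have "R (w 1) \<ge> 0"
    using pos_def_nonneg [OF M] by (simp add: R_def inner_H_matrix)
  \<comment> \<open>The learning rate makes the accumulated stability cost a multiple of
    \<open>D\<close>. As 1 / (p - 1) \<le> 3, both summands are at most 3D/4, and with D/2 from the
    vertex the total is 2D.\<close>
  moreover have "real T * \<kappa> = D / (4 * (p - 1)) + 3 * D / 4"
    using p1 T by (simp add: \<kappa>_def \<eta>2 field_simps)
  moreover have "D / (4 * (p - 1)) \<le> 3 * D / 4"
    using p1 D by (simp add: field_simps)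
  ultimately have "\<eta> * regret T l w \<le> 2 * D"
    by simp
  then have "regret T l w \<le> 2 * D / \<eta>"
    using \<eta>0 by (simp add: field_simps)
  also have "2 * D / \<eta> = 2 * sqrt (D * ((p - 1) * real T))"
  proof -
    have "D / \<eta> = D / (sqrt D / sqrt ((p - 1) * real T))"
      by (simp only: \<eta> real_sqrt_divide)
    also have "\<dots> = (D / sqrt D) * sqrt ((p - 1) * real T)"
      by simp
    also have "\<dots> = sqrt (D * ((p - 1) * real T))"
      using D by (simp only: real_div_sqrt real_sqrt_mult less_imp_le)
    finally show ?thesis
      by simp
  qed
  \<comment> \<open>Replacing p - 1 by p gives the logarithmic factor of the stated bound.\<close>
  also have "\<dots> \<le> 2 * sqrt (D * (p * real T))"
    using D T by (simp add: mult_left_mono mult_right_mono)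
  also have "D * (p * real T) = 2 * (16 * real CARD('d) + 1) * ln (real s + 1) * real T"
    by (simp add: D_def assms(8))
  finally show ?thesis .
qed

end
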